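(* Let $S$ be a self-adjoint subspace in $X^2$ and $A$ a closed Hermitian subspace in $X^2$ with $D(S)\subset D(A)$. If $A_s$ is $S_s$-compact, then $S+A$ is a self-adjoint subspace in $X^2$.
   Context: $X$ is a complex Hilbert space and $X^2=X\times X$ carries the inner product $\langle (x,f),(y,g)\rangle=\langle x,y\rangle+\langle f,g\rangle$. A subspace $T$ in $X^2$ means a linear subspace of $X^2$ (a linear relation); a linear operator in $X$ is identified with its graph. Notation: $D(T)=\{x:(x,f)\in T \text{ for some } f\}$, $T(x)=\{f:(x,f)\in T\}$. The adjoint is $T^*=\{(y,g)\in X^2:\langle g,x\rangle=\langle y,f\rangle \text{ for all }(x,f)\in T\}$; $T$ is Hermitian if $T\subset T^*$ and self-adjoint if $T=T^*$. For subspaces $S,A$ in $X^2$, $S+A=\{(x,f+g):(x,f)\in S,(x,g)\in A\}$. For a closed subspace $T$, set $T_\infty=\{(0,g)\in X^2:(0,g)\in T\}$ and $T_s=T\ominus T_\infty$ (orthogonal complement of $T_\infty$ in $T$), so $T=T_s\oplus T_\infty$; $T_s$ is the graph of a linear operator (the operator part of $T$) with $D(T_s)=D(T)$ and $R(T_s)\subset T(0)^\perp$. For linear operators $U,V$ in $X$ with $D(V)\subset D(U)$: $U$ is $V$-compact if $U|_{D(V)}$ is compact as a map from $(D(V),\|\cdot\|_V)$ into $X$, where $\|x\|_V=\|x\|+\|Vx\|$. *)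

theory Defs
  imports "HOL-Analysis.Analysis"
begin

class complex_vector = real_vector +
  fixes scaleC :: "complex \<Rightarrow> 'a \<Rightarrow> 'a" (infixr "*\<^sub>C" 75)
  assumes scaleC_add_right: "a *\<^sub>C (x + y) = a *\<^sub>C x + a *\<^sub>C y"
    and scaleC_add_left: "(a + b) *\<^sub>C x = a *\<^sub>C x + b *\<^sub>C x"
    and scaleC_scaleC: "a *\<^sub>C (b *\<^sub>C x) = (a * b) *\<^sub>C x"
    and scaleC_one: "1 *\<^sub>C x = x"
    and scaleR_scaleC: "scaleR r x = complex_of_real r *\<^sub>C x"

class complex_normed_vector = complex_vector + real_normed_vector

text \<open>Inner product, conjugate-linear in the first argument (the adjoint condition
  below is invariant under the choice of convention).\<close>
class complex_inner = complex_normed_vector +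
  fixes cinner :: "'a \<Rightarrow> 'a \<Rightarrow> complex"
  assumes cinner_commute: "cinner x y = cnj (cinner y x)"
    and cinner_add_left: "cinner (x + y) z = cinner x z + cinner y z"
    and cinner_scaleC_left: "cinner (r *\<^sub>C x) y = cnj r * cinner x y"
    and cinner_self_real: "Im (cinner x x) = 0"
    and cinner_self_nonneg: "0 \<le> Re (cinner x x)"
    and cinner_eq_zero_iff: "cinner x x = 0 \<longleftrightarrow> x = 0"
    and norm_eq_sqrt_cinner: "norm x = sqrt (Re (cinner x x))"

class chilbert_space = complex_inner + complete_space

definition lin_rel :: "('a::complex_vector \<times> 'a) set \<Rightarrow> bool" where
  "lin_rel T \<longleftrightarrow> (0, 0) \<in> T \<and>
     (\<forall>x f y g. (x, f) \<in> T \<longrightarrow> (y, g) \<in> T \<longrightarrow> (x + y, f + g) \<in> T) \<and>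
     (\<forall>c x f. (x, f) \<in> T \<longrightarrow> (c *\<^sub>C x, c *\<^sub>C f) \<in> T)"

definition rdom :: "('a \<times> 'a) set \<Rightarrow> 'a set" where
  "rdom T = {x. \<exists>f. (x, f) \<in> T}"

definition radj :: "('a::complex_inner \<times> 'a) set \<Rightarrow> ('a \<times> 'a) set" where
  "radj T = {(y, g). \<forall>x f. (x, f) \<in> T \<longrightarrow> cinner g x = cinner y f}"

definition hermitian_rel :: "('a::complex_inner \<times> 'a) set \<Rightarrow> bool" where
  "hermitian_rel T \<longleftrightarrow> T \<subseteq> radj T"

definition selfadjoint_rel :: "('a::complex_inner \<times> 'a) set \<Rightarrow> bool" where
  "selfadjoint_rel T \<longleftrightarrow> T = radj T"

definition rel_plus :: "('a::plus \<times> 'a) set \<Rightarrow> ('a \<times> 'a) set \<Rightarrow> ('a \<times> 'a) set" where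
  "rel_plus S A = {(x, h). \<exists>f g. (x, f) \<in> S \<and> (x, g) \<in> A \<and> h = f + g}"

definition cinner2 :: "'a::complex_inner \<times> 'a \<Rightarrow> 'a \<times> 'a \<Rightarrow> complex" where
  "cinner2 p q = cinner (fst p) (fst q) + cinner (snd p) (snd q)"

definition rel_inf :: "('a::zero \<times> 'a) set \<Rightarrow> ('a \<times> 'a) set" where
  "rel_inf T = {(x, g). x = 0 \<and> (0, g) \<in> T}"

definition rel_s :: "('a::complex_inner \<times> 'a) set \<Rightarrow> ('a \<times> 'a) set" where
  "rel_s T = {p \<in> T. \<forall>q \<in> rel_inf T. cinner2 p q = 0}"

text \<open>The operator whose graph is T (meaningful when T is single-valued).\<close>
definition graph_op :: "('a \<times> 'a) set \<Rightarrow> 'a \<Rightarrow> 'a" where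
  "graph_op T x = (THE f. (x, f) \<in> T)"

definition rel_compact_wrt :: "('a::complex_normed_vector \<times> 'a) set \<Rightarrow> ('a \<times> 'a) set \<Rightarrow> bool" where
  "rel_compact_wrt U V \<longleftrightarrow> rdom V \<subseteq> rdom U \<and>
     (\<forall>B. B \<subseteq> rdom V \<and> (\<exists>M. \<forall>x\<in>B. norm x + norm (graph_op V x) \<le> M)
          \<longrightarrow> compact (closure (graph_op U ` B)))"

end

theory Submission
  imports Defs
begin

text \<open>Relative compactness of the closed operator \<open>A\<^sub>s\<close> forces its \<open>S\<^sub>s\<close>-bound to be zero, since a
  sequence violating the bound would produce a nonzero element of \<open>A\<^sub>s(0)\<close>. The argument of Kato and
  Rellich then runs directly on relations: with \<open>R\<close> the resolvent of \<open>S\<close> at \<open>i\<mu>\<close> for \<open>\<bar>\<mu>\<bar>\<close> large, the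
  map \<open>A\<^sub>s R\<close> is a contraction, so \<open>S + A - i\<mu>\<close> is onto; a Hermitian relation for which both
  \<open>T - i\<mu>\<close> and \<open>T + i\<mu>\<close> are onto is self-adjoint.\<close>

section \<open>Complex inner product spaces\<close>

lemma scaleC_zero_left [simp]: "0 *\<^sub>C x = (0 :: 'a::complex_vector)"
  using scaleC_add_left[of 0 0 x] by simp

lemma scaleC_zero_right [simp]: "c *\<^sub>C 0 = (0 :: 'a::complex_vector)"
  using scaleC_add_right[of c 0 0] by simp

lemma scaleC_minus_left: "(- c) *\<^sub>C x = - (c *\<^sub>C (x :: 'a::complex_vector))"
  using scaleC_add_left[of c "- c" x] by (simp add: add_eq_0_iff)

lemma scaleC_minus_right: "c *\<^sub>C (- x) = - (c *\<^sub>C (x :: 'a::complex_vector))"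
  using scaleC_add_right[of c x "- x"] by (simp add: add_eq_0_iff)

lemma scaleC_diff_right: "c *\<^sub>C (x - y) = c *\<^sub>C x - c *\<^sub>C (y :: 'a::complex_vector)"
  using scaleC_add_right[of c x "- y"] by (simp add: scaleC_minus_right)

lemma scaleC_minus_one: "(-1) *\<^sub>C x = - (x :: 'a::complex_vector)"
  by (simp add: scaleC_minus_left scaleC_one)

lemma cinner_add_right: "cinner x (y + z) = cinner x y + cinner x (z :: 'a::complex_inner)"
  by (metis cinner_add_left cinner_commute complex_cnj_add)

lemma cinner_scaleC_right: "cinner x (c *\<^sub>C y) = c * cinner x (y :: 'a::complex_inner)"
  by (metis cinner_scaleC_left cinner_commute complex_cnj_mult complex_cnj_cnj)

lemma cinner_minus_left: "cinner (- x) y = - cinner x (y :: 'a::complex_inner)"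
  using cinner_scaleC_left[of "-1" x y] by (simp add: scaleC_minus_one)

lemma cinner_minus_right: "cinner x (- y) = - cinner x (y :: 'a::complex_inner)"
  using cinner_scaleC_right[of x "-1" y] by (simp add: scaleC_minus_one)

lemma cinner_diff_left: "cinner (x - y) z = cinner x z - cinner y (z :: 'a::complex_inner)"
  using cinner_add_left[of x "- y" z] by (simp add: cinner_minus_left)

lemma cinner_diff_right: "cinner x (y - z) = cinner x y - cinner x (z :: 'a::complex_inner)"
  using cinner_add_right[of x y "- z"] by (simp add: cinner_minus_right)

lemma cinner_zero_left [simp]: "cinner 0 x = (0 :: complex)"
  using cinner_diff_left[of x x x] by simp

lemma cinner_zero_right [simp]: "cinner x 0 = (0 :: complex)"
  using cinner_diff_right[of x x x] by simp

lemma norm_power2_cinner: "(norm x)\<^sup>2 = Re (cinner x (x :: 'a::complex_inner))"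
  by (simp add: norm_eq_sqrt_cinner cinner_self_nonneg)

lemma cinner_self: "cinner x x = of_real ((norm (x :: 'a::complex_inner))\<^sup>2)"
  by (simp add: complex_eq_iff norm_power2_cinner cinner_self_real)

lemma Re_cinner_commute: "Re (cinner y x) = Re (cinner x (y :: 'a::complex_inner))"
  by (subst cinner_commute) simp

section \<open>Norm identities and the Cauchy-Schwarz inequality\<close>

lemma norm_add_power2:
  "(norm (x + y))\<^sup>2 = (norm x)\<^sup>2 + (norm y)\<^sup>2 + 2 * Re (cinner x (y :: 'a::complex_inner))"
  by (simp add: norm_power2_cinner cinner_add_left cinner_add_right Re_cinner_commute[of y x])

lemma norm_diff_power2:
  "(norm (x - y))\<^sup>2 = (norm x)\<^sup>2 + (norm y)\<^sup>2 - 2 * Re (cinner x (y :: 'a::complex_inner))"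
  using norm_add_power2[of x "- y"] by (simp add: cinner_minus_right)

text \<open>The norm class gives homogeneity for real scalars; the complex case is read off from the
  inner product.\<close>

lemma norm_scaleC: "norm (c *\<^sub>C x) = cmod c * norm (x :: 'a::complex_inner)"
proof -
  have "cinner (c *\<^sub>C x) (c *\<^sub>C x) = of_real ((cmod c)\<^sup>2) * cinner x x"
    by (simp add: cinner_scaleC_left cinner_scaleC_right complex_norm_square mult_ac
          del: of_real_power)
  then have "(norm (c *\<^sub>C x))\<^sup>2 = (cmod c * norm x)\<^sup>2"
    by (simp add: norm_power2_cinner power_mult_distrib del: of_real_power)
  then show ?thesis
    by (simp add: power2_eq_iff_nonneg)
qed

text \<open>Pythagoras for \<open>v\<close> split along \<open>y\<close> and its orthogonal
  complement. It serves both Cauchy-Schwarz, through nonnegativity of the left side, and the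
  minimality argument for orthogonal projections.\<close>

lemma norm_diff_component_power2:
  fixes v y :: "'a::complex_inner"
  assumes "y \<noteq> 0"
  shows "(norm (v - (cinner y v / cinner y y) *\<^sub>C y))\<^sup>2 = (norm v)\<^sup>2 - (cmod (cinner y v) / norm y)\<^sup>2"
proof -
  define c where "c = cinner y v / cinner y y"
  have "cinner v (c *\<^sub>C y) = cinner y v * cnj (cinner y v) / of_real ((norm y)\<^sup>2)"
    unfolding c_def cinner_scaleC_right cinner_self by (subst cinner_commute[of v y]) simp
  also have "\<dots> = of_real ((cmod (cinner y v) / norm y)\<^sup>2)"
    by (simp add: complex_norm_square[symmetric] power_divide)
  finally have "Re (cinner v (c *\<^sub>C y)) = (cmod (cinner y v) / norm y)\<^sup>2"
    by simp
  moreover have "norm (c *\<^sub>C y) = cmod (cinner y v) / norm y"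
    using assms by (simp add: norm_scaleC c_def cinner_self norm_divide norm_power norm_mult
          power2_eq_square)
  ultimately show ?thesis
    unfolding c_def[symmetric] by (simp add: norm_diff_power2)
qed

lemma cinner_Cauchy_Schwarz: "cmod (cinner x y) \<le> norm x * norm (y :: 'a::complex_inner)"
proof (cases "x = 0")
  case False
  then have "(cmod (cinner x y) / norm x)\<^sup>2 \<le> (norm y)\<^sup>2"
    using norm_diff_component_power2[OF False, of y]
      zero_le_power2[of "norm (y - (cinner x y / cinner x x) *\<^sub>C x)"]
    by linarith
  then have "cmod (cinner x y) / norm x \<le> norm y"
    by (rule power2_le_imp_le) simp
  with False show ?thesis
    by (simp add: field_simps)
qed simp

text \<open>Over the reals conjugate-linearity is plain linearity, so \<open>cinner\<close> is
  bounded bilinear with constant 1 and the limit rules apply.\<close>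

lemma bounded_bilinear_cinner:
  "bounded_bilinear (cinner :: 'a::complex_inner \<Rightarrow> 'a \<Rightarrow> complex)"
proof
  show "\<exists>K. \<forall>a b :: 'a. norm (cinner a b) \<le> norm a * norm b * K"
    by (rule exI[of _ 1]) (simp add: cinner_Cauchy_Schwarz)
qed (simp_all add: cinner_add_left cinner_add_right scaleR_scaleC[of _ "_ :: 'a"] cinner_scaleC_left
      cinner_scaleC_right scaleR_conv_of_real)

lemmas tendsto_cinner = bounded_bilinear.tendsto[OF bounded_bilinear_cinner]

lemma bounded_linear_scaleC: "bounded_linear (\<lambda>x :: 'a::complex_inner. c *\<^sub>C x)"
  by (rule bounded_linear_intro[of _ "cmod c"])
     (simp_all add: scaleC_add_right scaleR_scaleC scaleC_scaleC norm_scaleC mult_ac)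

lemmas tendsto_scaleC = bounded_linear.tendsto[OF bounded_linear_scaleC]

section \<open>Orthogonal projection onto a closed subspace\<close>

lemma parallelogram:
  fixes x y :: "'a::complex_inner"
  shows "(norm (x + y))\<^sup>2 + (norm (x - y))\<^sup>2 = 2 * (norm x)\<^sup>2 + 2 * (norm y)\<^sup>2"
  by (simp add: norm_add_power2 norm_diff_power2)

text \<open>A minimising sequence for the distance from \<open>x\<close> to \<open>M\<close> is
  Cauchy by the parallelogram law. Its limit \<open>p\<close> attains the minimum, so removing from
  \<open>x - p\<close> its component along any \<open>y\<close> in \<open>M\<close> cannot shorten
  it, and that component vanishes.\<close>

lemma orthogonal_projection_exists:
  fixes M :: "'a::chilbert_space set"
  assumes zero: "0 \<in> M" and add: "\<And>x y. x \<in> M \<Longrightarrow> y \<in> M \<Longrightarrow> x + y \<in> M"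
    and scale: "\<And>c x. x \<in> M \<Longrightarrow> c *\<^sub>C x \<in> M" and closed: "closed M"
  shows "\<exists>m\<in>M. \<forall>y\<in>M. cinner y (x - m) = 0"
proof -
  define D where "D = (\<lambda>m. (norm (x - m))\<^sup>2) ` M"
  define d where "d = Inf D"
  have D_bdd: "bdd_below D" and D_ne: "D \<noteq> {}"
    unfolding D_def using zero by (auto intro!: bdd_belowI[of _ 0])
  have d_le: "d \<le> (norm (x - m))\<^sup>2" if "m \<in> M" for m
    unfolding d_def using that D_bdd by (auto intro!: cInf_lower simp: D_def)
  have "\<exists>m\<in>M. (norm (x - m))\<^sup>2 < d + 1 / real (Suc n)" for n
    using cInf_lessD[OF D_ne, of "d + 1 / real (Suc n)"] by (auto simp: d_def D_def)
  then obtain m where m: "\<And>n. m n \<in> M" "\<And>n. (norm (x - m n))\<^sup>2 < d + 1 / real (Suc n)"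
    by metis
  have dist_bound: "(norm (m k - m l))\<^sup>2 \<le> 2 / real (Suc k) + 2 / real (Suc l)" for k l
  proof -
    \<comment> \<open>The midpoint of two near-minimisers stays in \<open>M\<close>, hence is no
      closer to \<open>x\<close> than the infimum; this bounds from below the sum term of the
      parallelogram law.\<close>
    have "(1/2) *\<^sub>C (m k + m l) \<in> M"
      by (intro scale add m)
    then have "d \<le> (norm (x - (1/2) *\<^sub>C (m k + m l)))\<^sup>2"
      by (rule d_le)
    also have "x - (1/2) *\<^sub>C (m k + m l) = (1/2) *\<^sub>R ((x - m k) + (x - m l))"
      by (simp add: scaleR_scaleC[symmetric, where r = "1/2", simplified] algebra_simps
            scaleR_add_left[symmetric])
    also have "(norm \<dots>)\<^sup>2 = (norm ((x - m k) + (x - m l)))\<^sup>2 / 4"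
      by (simp add: power_mult_distrib power_divide)
    finally have "4 * d \<le> (norm ((x - m k) + (x - m l)))\<^sup>2"
      by simp
    moreover have "norm (m k - m l) = norm ((x - m k) - (x - m l))"
      by (simp add: norm_minus_commute)
    ultimately show ?thesis
      using parallelogram[of "x - m k" "x - m l"] m(2)[of k] m(2)[of l] by simp
  qed
  have "Cauchy m"
  proof (rule CauchyI)
    fix e :: real assume "0 < e"
    \<comment> \<open>Each of the two terms of \<open>dist_bound\<close> is twice a reciprocal, so a
      quarter of \<open>e\<^sup>2\<close> for the reciprocal makes the total less than
      \<open>e\<^sup>2\<close>.\<close>
    then obtain N where N: "inverse (real (Suc N)) < e\<^sup>2 / 4"
      using reals_Archimedean[of "e\<^sup>2 / 4"] by auto
    have "norm (m k - m l) < e" if "k \<ge> N" "l \<ge> N" for k l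
    proof -
      have "1 / real (Suc k) \<le> inverse (real (Suc N))" "1 / real (Suc l) \<le> inverse (real (Suc N))"
        using that by (simp_all add: field_simps)
      then have "(norm (m k - m l))\<^sup>2 < e\<^sup>2"
        using dist_bound[of k l] N by simp
      then show ?thesis
        using \<open>0 < e\<close> by (simp add: power2_less_imp_less)
    qed
    then show "\<exists>M. \<forall>k\<ge>M. \<forall>l\<ge>M. norm (m k - m l) < e"
      by blast
  qed
  then obtain p where p: "m \<longlonglongrightarrow> p"
    using Cauchy_convergent convergent_def by blast
  then have "p \<in> M"
    using closed m(1) closed_sequentially by blast
  have "(\<lambda>n. (norm (x - m n))\<^sup>2) \<longlonglongrightarrow> (norm (x - p))\<^sup>2"
    by (intro tendsto_intros p)
  moreover have "(\<lambda>n. d + 1 / real (Suc n)) \<longlonglongrightarrow> d + 0"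
    by (intro tendsto_intros LIMSEQ_inverse_real_of_nat[unfolded inverse_eq_divide])
  ultimately have "(norm (x - p))\<^sup>2 \<le> d + 0"
    by (rule LIMSEQ_le) (use m(2) in \<open>auto intro: less_imp_le\<close>)
  have "cinner y (x - p) = 0" if "y \<in> M" for y
  proof (cases "y = 0")
    case False
    define c where "c = cinner y (x - p) / cinner y y"
    \<comment> \<open>Minimality is tested against the competitor \<open>p + c *\<^sub>C y\<close>
      in \<open>M\<close>.\<close>
    have "d \<le> (norm (x - p - c *\<^sub>C y))\<^sup>2"
      using d_le[OF add[OF \<open>p \<in> M\<close> scale[OF that, of c]]] by (simp add: diff_diff_eq)
    then have "(cmod (cinner y (x - p)) / norm y)\<^sup>2 \<le> 0"
      using norm_diff_component_power2[OF False, of "x - p"] \<open>(norm (x - p))\<^sup>2 \<le> d + 0\<close>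
      by (simp only: c_def)
    with False show ?thesis
      by simp
  qed simp
  with \<open>p \<in> M\<close> show ?thesis
    by blast
qed

section \<open>Linear relations and their operator parts\<close>

lemma lin_relD:
  assumes "lin_rel T"
  shows lin_rel_zero: "(0, 0) \<in> T"
    and lin_rel_add: "(x, f) \<in> T \<Longrightarrow> (y, g) \<in> T \<Longrightarrow> (x + y, f + g) \<in> T"
    and lin_rel_scaleC: "(x, f) \<in> T \<Longrightarrow> (c *\<^sub>C x, c *\<^sub>C f) \<in> T"
  using assms by (auto simp: lin_rel_def)

lemma lin_rel_diff:
  assumes "lin_rel T" "(x, f) \<in> T" "(y, g) \<in> T"
  shows "(x - y, f - g) \<in> T"
  using lin_rel_add[OF assms(1,2) lin_rel_scaleC[OF assms(1,3), of "-1"]]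
  by (simp add: scaleC_minus_one)

section \<open>Sums and adjoints of relations\<close>

lemma mem_rel_plusI: "(x, f) \<in> S \<Longrightarrow> (x, g) \<in> A \<Longrightarrow> (x, f + g) \<in> rel_plus S A"
  by (auto simp: rel_plus_def)

lemma mem_rel_plusE:
  assumes "(x, h) \<in> rel_plus S A"
  obtains f g where "(x, f) \<in> S" "(x, g) \<in> A" "h = f + g"
  using assms by (auto simp: rel_plus_def)

lemma lin_rel_plus:
  assumes S: "lin_rel S" and A: "lin_rel A"
  shows "lin_rel (rel_plus S A)"
  unfolding lin_rel_def
proof (intro conjI allI impI)
  show "(0, 0) \<in> rel_plus S A"
    using mem_rel_plusI[OF lin_rel_zero[OF S] lin_rel_zero[OF A]] by simp
next
  fix x h y k assume "(x, h) \<in> rel_plus S A" "(y, k) \<in> rel_plus S A"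
  then obtain f g f' g' where "(x, f) \<in> S" "(x, g) \<in> A" "(y, f') \<in> S" "(y, g') \<in> A"
    and eq: "h = f + g" "k = f' + g'"
    by (metis mem_rel_plusE)
  then have "(x + y, (f + f') + (g + g')) \<in> rel_plus S A"
    by (intro mem_rel_plusI lin_rel_add[OF S] lin_rel_add[OF A])
  then show "(x + y, h + k) \<in> rel_plus S A"
    by (simp add: eq add_ac)
next
  fix c x h assume "(x, h) \<in> rel_plus S A"
  then obtain f g where "(x, f) \<in> S" "(x, g) \<in> A" and eq: "h = f + g"
    by (rule mem_rel_plusE)
  then have "(c *\<^sub>C x, c *\<^sub>C f + c *\<^sub>C g) \<in> rel_plus S A"
    by (intro mem_rel_plusI lin_rel_scaleC[OF S] lin_rel_scaleC[OF A])
  then show "(c *\<^sub>C x, c *\<^sub>C h) \<in> rel_plus S A"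
    by (simp add: eq scaleC_add_right)
qed

lemma hermitian_rel_plus:
  assumes "hermitian_rel S" "hermitian_rel A"
  shows "hermitian_rel (rel_plus S A)"
  using assms unfolding hermitian_rel_def radj_def rel_plus_def
  by (fastforce simp: cinner_add_left cinner_add_right)

text \<open>Each pair in \<open>T\<close> imposes on \<open>(y, g)\<close> an equation between
  continuous functions. Applied to \<open>S = radj S\<close>, this makes a self-adjoint relation
  closed.\<close>

lemma closed_radj: "closed (radj T)"
proof (rule closed_sequential_limits[THEN iffD2, rule_format])
  fix p l assume p: "(\<forall>n. p n \<in> radj T) \<and> p \<longlonglongrightarrow> l"
  then have lims: "(\<lambda>n. fst (p n)) \<longlonglongrightarrow> fst l" "(\<lambda>n. snd (p n)) \<longlonglongrightarrow> snd l"
    by (auto intro: tendsto_fst tendsto_snd)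
  have "cinner (snd l) x = cinner (fst l) f" if "(x, f) \<in> T" for x f
  proof (rule LIMSEQ_unique)
    show "(\<lambda>n. cinner (snd (p n)) x) \<longlonglongrightarrow> cinner (snd l) x"
      by (intro tendsto_cinner lims tendsto_const)
    have "cinner (snd (p n)) x = cinner (fst (p n)) f" for n
      using p that unfolding radj_def by (auto simp: case_prod_beta)
    then show "(\<lambda>n. cinner (snd (p n)) x) \<longlonglongrightarrow> cinner (fst l) f"
      by (simp add: tendsto_cinner lims)
  qed
  then show "l \<in> radj T"
    by (auto simp: radj_def case_prod_beta)
qed

section \<open>The operator part of a relation\<close>

lemma mem_rel_s_iff: "(x, f) \<in> rel_s T \<longleftrightarrow> (x, f) \<in> T \<and> (\<forall>g. (0, g) \<in> T \<longrightarrow> cinner f g = 0)"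
  by (auto simp: rel_s_def rel_inf_def cinner2_def)

lemma lin_rel_rel_s: "lin_rel T \<Longrightarrow> lin_rel (rel_s T)"
  by (auto simp: lin_rel_def mem_rel_s_iff cinner_add_left cinner_scaleC_left)

text \<open>Such a pair lies in \<open>rel_inf T\<close> as well, so \<open>g\<close> is orthogonal
  to itself. This is the single-valuedness of the operator part.\<close>

lemma rel_s_mul_zero: "(0, g) \<in> rel_s T \<Longrightarrow> g = 0"
  by (metis mem_rel_s_iff cinner_eq_zero_iff)

lemma closed_rel_s:
  fixes T :: "('a::complex_inner \<times> 'a) set"
  assumes "closed T"
  shows "closed (rel_s T)"
proof (rule closed_sequential_limits[THEN iffD2, rule_format])
  fix p l assume p: "(\<forall>n. p n \<in> rel_s T) \<and> p \<longlonglongrightarrow> l"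
  have "p n \<in> T" for n
    using p by (auto simp: rel_s_def)
  then have "l \<in> T"
    using assms p closed_sequentially by blast
  moreover have "cinner (snd l) g = 0" if "(0, g) \<in> T" for g
  proof (rule LIMSEQ_unique)
    show "(\<lambda>n. cinner (snd (p n)) g) \<longlonglongrightarrow> cinner (snd l) g"
      using p by (intro tendsto_cinner tendsto_const tendsto_snd) auto
    have "cinner (snd (p n)) g = 0" for n
      using p that mem_rel_s_iff[of "fst (p n)" "snd (p n)" T] by auto
    then show "(\<lambda>n. cinner (snd (p n)) g) \<longlonglongrightarrow> 0"
      by simp
  qed
  ultimately show "l \<in> rel_s T"
    using mem_rel_s_iff[of "fst l" "snd l" T] by simp
qed

text \<open>From a value \<open>f\<close> of \<open>T\<close> at \<open>x\<close> one subtracts its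
  projection \<open>m\<close> onto the closed subspace \<open>T(0)\<close>; \<open>f - m\<close> is
  still a value at \<open>x\<close> and is orthogonal to \<open>T(0)\<close>.\<close>

lemma rdom_rel_s:
  fixes T :: "('a::chilbert_space \<times> 'a) set"
  assumes "lin_rel T" "closed T"
  shows "rdom (rel_s T) = rdom T"
proof
  show "rdom T \<subseteq> rdom (rel_s T)"
  proof
    fix x assume "x \<in> rdom T"
    then obtain f where f: "(x, f) \<in> T"
      by (auto simp: rdom_def)
    define M where "M = {g. (0, g) \<in> T}"
    have "closed M"
    proof -
      have "M = (\<lambda>g. (0, g)) -` T"
        by (auto simp: M_def)
      then show ?thesis
        using assms(2) by (auto intro!: continuous_closed_vimage continuous_intros)
    qed
    then obtain m where m: "m \<in> M" "\<And>y. y \<in> M \<Longrightarrow> cinner y (f - m) = 0"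
      using orthogonal_projection_exists[of M f] lin_rel_zero[OF assms(1)]
        lin_rel_add[OF assms(1), of 0 _ 0] lin_rel_scaleC[OF assms(1), of 0]
      unfolding M_def by (metis (mono_tags, lifting) add.right_neutral mem_Collect_eq scaleC_zero_right)
    have "(x, f - m) \<in> T"
      using lin_rel_diff[OF assms(1) f, of 0 m] m(1) by (simp add: M_def)
    moreover have "cinner (f - m) g = 0" if "(0, g) \<in> T" for g
      using m(2)[of g] that cinner_commute[of "f - m" g] by (simp add: M_def)
    ultimately show "x \<in> rdom (rel_s T)"
      by (auto simp: rdom_def mem_rel_s_iff)
  qed
qed (auto simp: rdom_def mem_rel_s_iff)

text \<open>The two values differ by an element of \<open>T(0)\<close>, which is orthogonal to
  \<open>g\<close>; by Pythagoras the operator part selects the value of least norm.\<close>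

lemma norm_rel_s_le:
  assumes "lin_rel T" "(x, f) \<in> T" "(x, g) \<in> rel_s T"
  shows "norm g \<le> norm f"
proof -
  have "(0, f - g) \<in> T"
    using lin_rel_diff[OF assms(1,2), of x g] assms(3) by (simp add: mem_rel_s_iff)
  then have "cinner g (f - g) = 0"
    using assms(3) by (simp add: mem_rel_s_iff)
  then have "(norm f)\<^sup>2 = (norm g)\<^sup>2 + (norm (f - g))\<^sup>2"
    using norm_add_power2[of g "f - g"] by simp
  then have "(norm g)\<^sup>2 \<le> (norm f)\<^sup>2"
    by simp
  then show ?thesis
    by (rule power2_le_imp_le) simp
qed

text \<open>Two values at \<open>x\<close> differ by a value at 0, so for a linear relation
  triviality over 0 is single-valuedness and the definite description in \<open>graph_op\<close> is
  proper.\<close>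

lemma graph_op_eq:
  assumes "lin_rel U" "\<And>g. (0, g) \<in> U \<Longrightarrow> g = 0" "(x, f) \<in> U"
  shows "graph_op U x = f"
  unfolding graph_op_def
proof (rule the_equality)
  show "g = f" if "(x, g) \<in> U" for g
    using assms(2)[of "g - f"] lin_rel_diff[OF assms(1) that assms(3)] by simp
qed fact

lemma graph_op_mem:
  assumes "lin_rel U" "\<And>g. (0, g) \<in> U \<Longrightarrow> g = 0" "x \<in> rdom U"
  shows "(x, graph_op U x) \<in> U"
  using assms graph_op_eq[OF assms(1,2)] by (auto simp: rdom_def)

section \<open>Relative compactness implies relative bound zero\<close>

text \<open>If no \<open>C\<close> works, violators with constants \<open>n + 1\<close> can be
  scaled to graph norm 1. Compactness makes their images under \<open>u\<close> converge along a
  subsequence, the growing constants force the vectors themselves to 0, and closedness of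
  \<open>U\<close> then makes the image limit 0. So the graph norms tend to 0, a
  contradiction.\<close>

lemma rel_compact_wrt_bound:
  fixes U V :: "('a::complex_inner \<times> 'a) set"
  assumes U: "lin_rel U" "\<And>g. (0, g) \<in> U \<Longrightarrow> g = 0" and V: "lin_rel V" "\<And>g. (0, g) \<in> V \<Longrightarrow> g = 0"
    and "closed U" and cpt: "rel_compact_wrt U V" and "\<epsilon> > 0"
  shows "\<exists>C>0. \<forall>x\<in>rdom V. norm (graph_op U x) \<le> \<epsilon> * norm (graph_op V x) + C * norm x"
proof (rule ccontr)
  assume contra: "\<not> ?thesis"
  define u v where "u = graph_op U" and "v = graph_op V"
  have dom: "rdom V \<subseteq> rdom U"
    using cpt by (simp add: rel_compact_wrt_def)
  have uU: "(x, u x) \<in> U" if "x \<in> rdom V" for x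
    unfolding u_def using graph_op_mem[OF U] that dom by blast
  have vV: "(x, v x) \<in> V" if "x \<in> rdom V" for x
    unfolding v_def using graph_op_mem[OF V] that by blast
  have "\<exists>y\<in>rdom V. norm y + norm (v y) = 1 \<and> \<epsilon> * norm (v y) + real (Suc n) * norm y < norm (u y)" for n
  proof -
    obtain x where x: "x \<in> rdom V" "\<epsilon> * norm (v x) + real (Suc n) * norm x < norm (u x)"
      using contra unfolding u_def v_def not_ex de_Morgan_conj
      by (metis not_le of_nat_0_less_iff zero_less_Suc)
    have "x \<noteq> 0"
    proof
      assume "x = 0"
      then have "u x = 0"
        using uU[OF x(1)] U(2) by simp
      moreover have "0 \<le> \<epsilon> * norm (v x)"
        using \<open>\<epsilon> > 0\<close> by simp
      ultimately show False
        using x(2) \<open>x = 0\<close> by simp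
    qed
    \<comment> \<open>\<open>r\<close> is the graph norm of \<open>x\<close>. The violated
      inequality is homogeneous, so it survives scaling by \<open>1 / r\<close>.\<close>
    define r where "r = norm x + norm (v x)"
    have "r > 0"
      using \<open>x \<noteq> 0\<close> by (simp add: r_def add_pos_nonneg)
    define c :: complex where "c = of_real (1 / r)"
    have c: "cmod c = 1 / r"
      using \<open>r > 0\<close> by (simp add: c_def norm_divide)
    have cv: "v (c *\<^sub>C x) = c *\<^sub>C v x"
      unfolding v_def by (rule graph_op_eq[OF V lin_rel_scaleC[OF V(1) vV[OF x(1), unfolded v_def]]])
    have cu: "u (c *\<^sub>C x) = c *\<^sub>C u x"
      unfolding u_def by (rule graph_op_eq[OF U lin_rel_scaleC[OF U(1) uU[OF x(1), unfolded u_def]]])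
    have "c *\<^sub>C x \<in> rdom V"
      using lin_rel_scaleC[OF V(1) vV[OF x(1)]] by (auto simp: rdom_def)
    moreover have "norm (c *\<^sub>C x) + norm (v (c *\<^sub>C x)) = 1"
      using \<open>r > 0\<close> unfolding cv norm_scaleC c by (simp add: add_divide_distrib[symmetric] r_def)
    moreover have "\<epsilon> * norm (v (c *\<^sub>C x)) + real (Suc n) * norm (c *\<^sub>C x) < norm (u (c *\<^sub>C x))"
      using divide_strict_right_mono[OF x(2) \<open>r > 0\<close>] unfolding cu cv norm_scaleC c
      by (simp add: add_divide_distrib)
    ultimately show ?thesis
      by blast
  qed
  then obtain y where y: "\<And>n. y n \<in> rdom V" "\<And>n. norm (y n) + norm (v (y n)) = 1"
    "\<And>n. \<epsilon> * norm (v (y n)) + real (Suc n) * norm (y n) < norm (u (y n))"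
    by metis
  have "compact (closure (u ` range y))"
  proof -
    have "range y \<subseteq> rdom V \<and> (\<exists>M. \<forall>x\<in>range y. norm x + norm (graph_op V x) \<le> M)"
      using y(1) y(2)[unfolded v_def] by (auto intro!: exI[of _ 1])
    then show ?thesis
      using cpt unfolding rel_compact_wrt_def u_def by blast
  qed
  moreover have "\<forall>n. u (y n) \<in> closure (u ` range y)"
    using closure_subset[of "u ` range y"] by fast
  ultimately obtain l r where r: "strict_mono r" "(\<lambda>n. u (y (r n))) \<longlonglongrightarrow> l"
    unfolding compact_eq_seq_compact_metric by (rule seq_compactE) (auto simp: o_def)
  have bound0: "(\<lambda>n. norm (u (y (r n))) * (1 / real (Suc n))) \<longlonglongrightarrow> norm l * 0"
    by (intro tendsto_intros r LIMSEQ_inverse_real_of_nat[unfolded inverse_eq_divide])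
  \<comment> \<open>A strictly increasing \<open>r\<close> satisfies \<open>n \<le> r n\<close>, so
    the constant at index \<open>r n\<close> is at least \<open>n + 1\<close>.\<close>
  have y_le: "norm (y (r n)) \<le> norm (u (y (r n))) * (1 / real (Suc n))" for n
  proof -
    have "real (Suc n) * norm (y (r n)) \<le> real (Suc (r n)) * norm (y (r n))"
      using seq_suble[OF r(1), of n] by (intro mult_right_mono) auto
    also have "\<dots> \<le> norm (u (y (r n)))"
      using y(3)[of "r n"] mult_nonneg_nonneg[OF less_imp_le[OF \<open>\<epsilon> > 0\<close>], of "norm (v (y (r n)))"]
      by (metis add_increasing le_less_trans less_imp_le order_refl norm_ge_zero)
    finally show ?thesis
      by (simp add: field_simps)
  qed
  have y0: "(\<lambda>n. y (r n)) \<longlonglongrightarrow> 0"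
    by (rule Lim_null_comparison[OF always_eventually bound0[unfolded mult_zero_right]])
       (use y_le in blast)
  have "(\<lambda>n. (y (r n), u (y (r n)))) \<longlonglongrightarrow> (0, l)"
    by (intro tendsto_Pair y0 r)
  then have "(0, l) \<in> U"
    using \<open>closed U\<close> uU[OF y(1)] closed_sequentially[of U "\<lambda>n. (y (r n), u (y (r n)))"] by blast
  then have "l = 0"
    by (rule U)
  \<comment> \<open>The same violated inequality also controls \<open>v\<close> by \<open>u\<close>,
    so the part of the graph norm coming from \<open>v\<close> vanishes in the limit together with
    \<open>u\<close>.\<close>
  have "norm (v (y (r n))) \<le> norm (u (y (r n))) / \<epsilon>" for n
  proof -
    have "\<epsilon> * norm (v (y (r n))) \<le> norm (u (y (r n)))"
      using y(3)[of "r n"] by (smt (verit) mult_nonneg_nonneg norm_ge_zero of_nat_0_le_iff)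
    then show ?thesis
      using \<open>\<epsilon> > 0\<close> by (simp add: field_simps)
  qed
  then have "1 \<le> norm (y (r n)) + norm (u (y (r n))) / \<epsilon>" for n
    using y(2)[of "r n"] by (metis add_left_mono)
  moreover have "(\<lambda>n. norm (y (r n)) + norm (u (y (r n))) / \<epsilon>) \<longlonglongrightarrow> norm (0 :: 'a) + norm l / \<epsilon>"
    using \<open>\<epsilon> > 0\<close> by (intro tendsto_intros y0 r) simp
  ultimately have "1 \<le> norm (0 :: 'a) + norm l / \<epsilon>"
    by (intro LIMSEQ_le_const) auto
  with \<open>l = 0\<close> show False
    by simp
qed

section \<open>Ranges of shifted relations\<close>

text \<open>The number \<open>cinner f x\<close> is real, so the cross term with an imaginary
  multiple of \<open>x\<close> has real part 0. The identity bounds both \<open>norm f\<close> and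
  \<open>\<bar>\<mu>\<bar> * norm x\<close> by the norm of the shifted value.\<close>

lemma hermitian_norm_shift:
  assumes "hermitian_rel T" "(x, f) \<in> T"
  shows "(norm (f - (\<i> * of_real \<mu>) *\<^sub>C x))\<^sup>2 = (norm f)\<^sup>2 + \<mu>\<^sup>2 * (norm x)\<^sup>2"
proof -
  have "cinner f x = cinner x f"
    using assms by (auto simp: hermitian_rel_def radj_def)
  then have "Im (cinner f x) = 0"
    using cinner_commute[of f x] by (simp add: complex_eq_iff)
  then have "Re (cinner f ((\<i> * of_real \<mu>) *\<^sub>C x)) = 0"
    by (simp add: cinner_scaleC_right)
  then show ?thesis
    by (simp add: norm_diff_power2 norm_scaleC norm_mult power_mult_distrib)
qed

text \<open>Membership of \<open>(x, h + k *\<^sub>C x)\<close> in \<open>S\<close> says that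
  \<open>h\<close> is a value of \<open>S - k\<close> at \<open>x\<close>. The range
  \<open>M\<close> of \<open>S - k\<close> is closed by the norm identity, and a vector
  \<open>w\<close> orthogonal to it would be an eigenvector of \<open>S\<close> for the non-real
  number \<open>- k\<close>, so \<open>w = 0\<close>.\<close>

lemma selfadjoint_shift_surj:
  fixes S :: "('a::chilbert_space \<times> 'a) set"
  assumes S: "lin_rel S" "selfadjoint_rel S" and "\<mu> \<noteq> 0"
  shows "\<exists>x. (x, h + (\<i> * of_real \<mu>) *\<^sub>C x) \<in> S"
proof -
  define k :: complex where "k = \<i> * of_real \<mu>"
  define M where "M = {h. \<exists>x. (x, h + k *\<^sub>C x) \<in> S}"
  have herm: "hermitian_rel S" and eq: "S = radj S"
    using S(2) by (auto simp: selfadjoint_rel_def hermitian_rel_def)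
  have "closed S"
    by (subst eq) (rule closed_radj)
  have "closed M"
  proof (rule closed_sequential_limits[THEN iffD2, rule_format])
    fix h l assume "(\<forall>n. h n \<in> M) \<and> h \<longlonglongrightarrow> l"
    then obtain x where x: "\<And>n. (x n, h n + k *\<^sub>C x n) \<in> S" and h: "h \<longlonglongrightarrow> l"
      unfolding M_def by (simp, metis)
    \<comment> \<open>The inverse of \<open>S - k\<close> is Lipschitz, so convergence of the values
      \<open>h n\<close> passes to the arguments \<open>x n\<close>.\<close>
    have x_le: "\<bar>\<mu>\<bar> * norm (x m - x n) \<le> norm (h m - h n)" for m n
    proof -
      have "(h m + k *\<^sub>C x m) - (h n + k *\<^sub>C x n) - k *\<^sub>C (x m - x n) = h m - h n"
        by (simp add: scaleC_diff_right)
      then have "(norm (h m - h n))\<^sup>2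
          = (norm ((h m + k *\<^sub>C x m) - (h n + k *\<^sub>C x n)))\<^sup>2 + \<mu>\<^sup>2 * (norm (x m - x n))\<^sup>2"
        using hermitian_norm_shift[OF herm lin_rel_diff[OF S(1) x x], of m n \<mu>]
        by (simp only: k_def[symmetric])
      then have "(\<bar>\<mu>\<bar> * norm (x m - x n))\<^sup>2 \<le> (norm (h m - h n))\<^sup>2"
        by (simp add: power_mult_distrib)
      then show ?thesis
        by (rule power2_le_imp_le) simp
    qed
    have "Cauchy x"
    proof (rule CauchyI)
      fix e :: real assume "0 < e"
      then have "0 < \<bar>\<mu>\<bar> * e"
        using \<open>\<mu> \<noteq> 0\<close> by simp
      then obtain N where N: "\<forall>m\<ge>N. \<forall>n\<ge>N. norm (h m - h n) < \<bar>\<mu>\<bar> * e"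
        using CauchyD[OF LIMSEQ_imp_Cauchy[OF h]] by blast
      have "norm (x m - x n) < e" if "m \<ge> N" "n \<ge> N" for m n
      proof -
        have "\<bar>\<mu>\<bar> * norm (x m - x n) < \<bar>\<mu>\<bar> * e"
          using x_le[of m n] N that by (meson le_less_trans)
        then show ?thesis
          using \<open>\<mu> \<noteq> 0\<close> by simp
      qed
      then show "\<exists>M. \<forall>m\<ge>M. \<forall>n\<ge>M. norm (x m - x n) < e"
        by blast
    qed
    then obtain z where "x \<longlonglongrightarrow> z"
      using Cauchy_convergent convergent_def by blast
    then have "(\<lambda>n. (x n, h n + k *\<^sub>C x n)) \<longlonglongrightarrow> (z, l + k *\<^sub>C z)"
      by (intro tendsto_intros tendsto_scaleC h)
    then have "(z, l + k *\<^sub>C z) \<in> S"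
      using \<open>closed S\<close> x closed_sequentially[of S "\<lambda>n. (x n, h n + k *\<^sub>C x n)"] by blast
    then show "l \<in> M"
      by (auto simp: M_def)
  qed
  moreover have "0 \<in> M"
    unfolding M_def using lin_rel_zero[OF S(1)] by (auto intro!: exI[of _ 0])
  moreover have "a + b \<in> M" if ab: "a \<in> M" "b \<in> M" for a b
  proof -
    obtain x y where "(x, a + k *\<^sub>C x) \<in> S" "(y, b + k *\<^sub>C y) \<in> S"
      using ab by (auto simp: M_def)
    then have "(x + y, (a + b) + k *\<^sub>C (x + y)) \<in> S"
      using lin_rel_add[OF S(1)] by (fastforce simp: scaleC_add_right algebra_simps)
    then show ?thesis
      by (auto simp: M_def)
  qed
  moreover have "c *\<^sub>C a \<in> M" if a: "a \<in> M" for c a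
  proof -
    obtain x where "(x, a + k *\<^sub>C x) \<in> S"
      using a by (auto simp: M_def)
    then have "(c *\<^sub>C x, c *\<^sub>C a + k *\<^sub>C (c *\<^sub>C x)) \<in> S"
      using lin_rel_scaleC[OF S(1)] by (fastforce simp: scaleC_add_right scaleC_scaleC mult.commute)
    then show ?thesis
      by (auto simp: M_def)
  qed
  ultimately obtain m where m: "m \<in> M" "\<And>y. y \<in> M \<Longrightarrow> cinner y (h - m) = 0"
    using orthogonal_projection_exists[of M h] by blast
  define w where "w = h - m"
  \<comment> \<open>Orthogonality to the range together with \<open>cnj k = - k\<close> puts
    \<open>(w, - k *\<^sub>C w)\<close> into \<open>radj S\<close>, which is
    \<open>S\<close>.\<close>
  have "cinner (- k *\<^sub>C w) x = cinner w f" if "(x, f) \<in> S" for x f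
  proof -
    have "f - k *\<^sub>C x \<in> M"
      using that by (auto simp: M_def intro!: exI[of _ x])
    then have "cinner w (f - k *\<^sub>C x) = 0"
      using m(2) cinner_commute[of w "f - k *\<^sub>C x"] by (simp add: w_def)
    then show ?thesis
      by (simp add: cinner_diff_right cinner_scaleC_right cinner_scaleC_left k_def)
  qed
  then have w: "(w, - k *\<^sub>C w) \<in> S"
    by (subst eq) (simp add: radj_def)
  \<comment> \<open>With the shift \<open>- \<mu>\<close> the left side is the norm of 0, while both
    terms on the right equal \<open>\<mu>\<^sup>2 * (norm w)\<^sup>2\<close>.\<close>
  then have "(norm (- k *\<^sub>C w - (\<i> * of_real (- \<mu>)) *\<^sub>C w))\<^sup>2 = (norm (- k *\<^sub>C w))\<^sup>2 + \<mu>\<^sup>2 * (norm w)\<^sup>2"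
    using hermitian_norm_shift[OF herm w, of "- \<mu>"] by simp
  then have "0 = 2 * (\<mu>\<^sup>2 * (norm w)\<^sup>2)"
    by (simp add: k_def norm_scaleC norm_mult power_mult_distrib)
  then have "h = m"
    using \<open>\<mu> \<noteq> 0\<close> by (simp add: w_def)
  with m(1) show ?thesis
    by (simp add: M_def k_def)
qed

text \<open>Given \<open>(y, g)\<close> in the adjoint, surjectivity of \<open>T - k\<close>
  provides a pair of \<open>T\<close> with the same value under the shift. The difference
  \<open>z\<close> of the first components satisfies \<open>(z, k z)\<close> in the adjoint, and
  surjectivity of \<open>T + k\<close> forces \<open>z = 0\<close>.\<close>

lemma hermitian_shifts_surj_imp_selfadjoint:
  assumes "lin_rel T" "hermitian_rel T"
    and surj1: "\<And>h. \<exists>x. (x, h + (\<i> * of_real \<mu>) *\<^sub>C x) \<in> T"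
    and surj2: "\<And>h. \<exists>x. (x, h + (\<i> * of_real (- \<mu>)) *\<^sub>C x) \<in> T"
  shows "selfadjoint_rel T"
  unfolding selfadjoint_rel_def
proof
  show "T \<subseteq> radj T"
    using assms(2) by (simp add: hermitian_rel_def)
  define k :: complex where "k = \<i> * of_real \<mu>"
  show "radj T \<subseteq> T"
  proof clarify
    fix y g assume yg: "(y, g) \<in> radj T"
    obtain x where x: "(x, (g - k *\<^sub>C y) + k *\<^sub>C x) \<in> T"
      using surj1 unfolding k_def by blast
    define z where "z = y - x"
    \<comment> \<open>The target is \<open>z\<close> itself: since \<open>cnj k = - k\<close>,
      pairing with \<open>w\<close> cancels the shift terms and leaves
      \<open>cinner z z = 0\<close>.\<close>
    obtain w where w: "(w, z + (- k) *\<^sub>C w) \<in> T"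
      using surj2[of z] by (auto simp: k_def)
    have "cinner g w = cinner y (z + (- k) *\<^sub>C w)"
      using yg w by (auto simp: radj_def)
    moreover have "cinner ((g - k *\<^sub>C y) + k *\<^sub>C x) w = cinner x (z + (- k) *\<^sub>C w)"
      using assms(2) x w by (auto simp: hermitian_rel_def radj_def)
    ultimately have "cinner (k *\<^sub>C z) w = cinner z (z + (- k) *\<^sub>C w)"
      unfolding z_def by (simp add: cinner_add_left cinner_diff_left scaleC_diff_right algebra_simps)
    then have "cinner z z = 0"
      by (simp add: cinner_add_right cinner_scaleC_left cinner_scaleC_right k_def)
    then have "y = x"
      by (simp add: cinner_eq_zero_iff z_def)
    with x show "(y, g) \<in> T"
      by simp
  qed
qed

text \<open>With \<open>R\<close> the resolvent of \<open>S\<close> at \<open>k\<close> and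
  \<open>a\<close> the operator part of \<open>A\<close>, a solution of
  \<open>u + a (R u) = h\<close> yields the preimage \<open>R u\<close> of \<open>h\<close>. Such a
  \<open>u\<close> is a fixed point of a contraction.\<close>

lemma rel_plus_shift_surj:
  fixes S A :: "('a::chilbert_space \<times> 'a) set"
  assumes S: "lin_rel S" "selfadjoint_rel S" and A: "lin_rel A"
    and dom: "rdom S \<subseteq> rdom (rel_s A)"
    and bound: "\<And>x. x \<in> rdom S \<Longrightarrow>
      norm (graph_op (rel_s A) x) \<le> norm (graph_op (rel_s S) x) / 4 + C * norm x"
    and "C > 0" "\<bar>\<mu>\<bar> = 4 * C"
  shows "\<exists>x. (x, h + (\<i> * of_real \<mu>) *\<^sub>C x) \<in> rel_plus S A"
proof -
  define k :: complex where "k = \<i> * of_real \<mu>"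
  define a where "a = graph_op (rel_s A)"
  note As = lin_rel_rel_s[OF A] rel_s_mul_zero[of _ A]
  note Ss = lin_rel_rel_s[OF S(1)] rel_s_mul_zero[of _ S]
  have herm: "hermitian_rel S" and "closed S"
    using S(2) closed_radj[of S] by (auto simp: selfadjoint_rel_def hermitian_rel_def)
  have a_mem: "(x, a x) \<in> rel_s A" if "x \<in> rdom S" for x
    unfolding a_def using graph_op_mem[OF As] that dom by blast
  \<comment> \<open>The least-norm value of \<open>S\<close> at \<open>x\<close> and
    \<open>4 * C * norm x\<close> are both at most \<open>norm h\<close>, so each term of
    \<open>bound\<close> contributes at most a quarter of \<open>norm h\<close>. This is the origin
    of \<open>\<bar>\<mu>\<bar> = 4 * C\<close>.\<close>
  have a_le: "norm (a x) \<le> norm h / 2" if x: "(x, h + k *\<^sub>C x) \<in> S" for x h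
  proof -
    have x_dom: "x \<in> rdom S"
      using x by (auto simp: rdom_def)
    then have "(x, graph_op (rel_s S) x) \<in> rel_s S"
      by (intro graph_op_mem[OF Ss]) (auto simp: rdom_rel_s[OF S(1) \<open>closed S\<close>])
    then have "norm (graph_op (rel_s S) x) \<le> norm (h + k *\<^sub>C x)"
      using norm_rel_s_le[OF S(1) x] by blast
    moreover have "(norm h)\<^sup>2 = (norm (h + k *\<^sub>C x))\<^sup>2 + (\<bar>\<mu>\<bar> * norm x)\<^sup>2"
      using hermitian_norm_shift[OF herm x, of \<mu>] by (simp add: k_def power_mult_distrib)
    then have "(norm (h + k *\<^sub>C x))\<^sup>2 \<le> (norm h)\<^sup>2" "(\<bar>\<mu>\<bar> * norm x)\<^sup>2 \<le> (norm h)\<^sup>2"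
      by simp_all
    then have "norm (h + k *\<^sub>C x) \<le> norm h" "\<bar>\<mu>\<bar> * norm x \<le> norm h"
      by (blast intro: power2_le_imp_le norm_ge_zero)+
    ultimately show ?thesis
      using bound[OF x_dom] \<open>\<bar>\<mu>\<bar> = 4 * C\<close> by (simp add: a_def)
  qed
  have "\<mu> \<noteq> 0"
    using assms by auto
  then obtain R where R: "\<And>h. (R h, h + k *\<^sub>C R h) \<in> S"
    using selfadjoint_shift_surj[OF S] unfolding k_def by metis
  have R_dom: "R h \<in> rdom S" for h
    using R by (auto simp: rdom_def)
  \<comment> \<open>\<open>R u - R v\<close> solves the shifted equation for \<open>u - v\<close>,
    so \<open>a_le\<close> applies to the difference and gives the contraction factor 1/2.\<close>
  have "dist (h - a (R u)) (h - a (R v)) \<le> 1/2 * dist u v" for u v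
  proof -
    have "(R u - R v, (u - v) + k *\<^sub>C (R u - R v)) \<in> S"
      using lin_rel_diff[OF S(1) R R, of u v] by (simp add: scaleC_diff_right algebra_simps)
    then have "norm (a (R u - R v)) \<le> norm (u - v) / 2"
      by (rule a_le)
    moreover have "a (R u - R v) = a (R u) - a (R v)"
      unfolding a_def
      by (rule graph_op_eq[OF As lin_rel_diff[OF As(1) a_mem[OF R_dom] a_mem[OF R_dom], unfolded a_def]])
    ultimately show ?thesis
      by (simp add: dist_norm norm_minus_commute)
  qed
  then have "\<exists>!u. h - a (R u) = u"
    by (intro banach_fix_type[of "1/2"]) auto
  then obtain u where u: "h - a (R u) = u"
    by blast
  have "(R u, a (R u)) \<in> A"
    using a_mem[OF R_dom] by (simp add: mem_rel_s_iff)
  then have "(R u, (u + k *\<^sub>C R u) + a (R u)) \<in> rel_plus S A"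
    using R by (intro mem_rel_plusI)
  moreover have "(u + k *\<^sub>C R u) + a (R u) = h + k *\<^sub>C R u"
    using u by (simp add: algebra_simps)
  ultimately show ?thesis
    unfolding k_def by metis
qed

theorem theorem4p3:
  fixes S A :: "('a::chilbert_space \<times> 'a) set"
  assumes "lin_rel S" and "selfadjoint_rel S"
    and "lin_rel A" and "closed A" and "hermitian_rel A"
    and "rdom S \<subseteq> rdom A"
    and "rel_compact_wrt (rel_s A) (rel_s S)"
  shows "lin_rel (rel_plus S A) \<and> selfadjoint_rel (rel_plus S A)"
proof
  show lin: "lin_rel (rel_plus S A)"
    using assms by (simp add: lin_rel_plus)
  have "hermitian_rel S" "closed S"
    using assms(2) closed_radj[of S] by (auto simp: selfadjoint_rel_def hermitian_rel_def)
  have domS: "rdom (rel_s S) = rdom S" and domA: "rdom S \<subseteq> rdom (rel_s A)"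
    using assms \<open>closed S\<close> by (simp_all add: rdom_rel_s)
  \<comment> \<open>Any positive relative bound is available; 1/4 is the one that leads to the
    contraction factor 1/2.\<close>
  obtain C where "C > 0" and bound: "\<forall>x\<in>rdom (rel_s S).
      norm (graph_op (rel_s A) x) \<le> 1/4 * norm (graph_op (rel_s S) x) + C * norm x"
    using rel_compact_wrt_bound[OF lin_rel_rel_s[OF assms(3)] rel_s_mul_zero[of _ A]
        lin_rel_rel_s[OF assms(1)] rel_s_mul_zero[of _ S] closed_rel_s[OF assms(4)] assms(7),
        where \<epsilon> = "1/4"]
    by auto
  \<comment> \<open>The condition involves only the absolute value of \<open>\<mu>\<close>, so it
    covers the two shifts \<open>4 * C\<close> and \<open>- (4 * C)\<close> required by the
    self-adjointness criterion.\<close>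
  have surj: "\<exists>x. (x, h + (\<i> * of_real \<mu>) *\<^sub>C x) \<in> rel_plus S A" if "\<bar>\<mu>\<bar> = 4 * C" for \<mu> h
    by (rule rel_plus_shift_surj[OF assms(1-3) domA _ \<open>C > 0\<close> that]) (use bound domS in auto)
  show "selfadjoint_rel (rel_plus S A)"
    by (rule hermitian_shifts_surj_imp_selfadjoint[OF lin hermitian_rel_plus, of "4 * C"])
       (use \<open>hermitian_rel S\<close> assms(5) surj[of "4 * C"] surj[of "- (4 * C)"] \<open>C > 0\<close> in auto)
qed

end
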